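(* For every point $(p,J_p)\in Z^+(S^6,g_0)$ there exists a 1-parameter family of smooth sections $\mathcal{I}$ of the twistor bundle $\pi:Z^+(S^6,g_0)\to S^6$, each passing through $(p,J_p)$ (that is, $\mathcal{I}_p=J_p$), and each defining a nearly Kähler structure $(g_0,\mathcal{I})$ on the round sphere $(S^6,g_0)$.
   Context: Let $\mathbb{O}$ be the algebra of Cayley numbers (octonions) and identify $\mathbb{R}^7$ with the purely imaginary Cayley numbers, with inner product $\langle x,y\rangle=-\mathrm{Re}(xy)$. $S^6\subset\mathbb{R}^7$ is the unit sphere and $g_0$ is the induced round metric. For $x\in S^6$ let $\mathcal{J}_x:T_xS^6\to T_xS^6$, $\mathcal{J}_x(y)=y\cdot x$ (Cayley multiplication); this is an almost complex structure on $S^6$. $S^6$ carries the orientation induced from $\mathbb{R}^7$, with $\mathbb{R}^7$ oriented so that $\mathcal{J}$ induces this orientation. The twistor bundle is $Z^+(S^6,g_0)=\{(x,J_x): x\in S^6,\ J_x:T_xS^6\to T_xS^6 \text{ linear and } g_0\text{-orthogonal},\ J_x^2=-1,\ J_x \text{ induces the given orientation}\}$ with projection $\pi(x,J_x)=x$; its fibers are diffeomorphic to $SO(6)/U(3)$. A smooth section is the same as an almost complex structure on $S^6$ that is $g_0$-orthogonal and compatible with the orientation. An almost Hermitian structure $(g,J)$ is nearly Kähler if $(\nabla_XJ)X=0$ for all tangent vectors $X$, where $\nabla$ is the Levi-Civita connection of $g$. A 1-parameter family means a family indexed by a real parameter ranging over an interval of positive length, with distinct parameter values giving distinct sections. *)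

theory Defs
  imports "HOL-Analysis.Analysis"
begin

section \<open>Cayley numbers\<close>

text \<open>
  The Cayley--Dickson construction, applied to the complex numbers to obtain the quaternions and
  applied to the quaternions to obtain the Cayley numbers. In both steps the product is
  \<open>(a, b) (c, d) = (a c - d* b, d a + b c*)\<close>, where \<open>*\<close> is conjugation.
\<close>

type_synonym quat = "complex \<times> complex"
type_synonym octo = "quat \<times> quat"

definition quat_cnj :: "quat \<Rightarrow> quat" where
  "quat_cnj = (\<lambda>(a, b). (cnj a, - b))"

definition quat_mult :: "quat \<Rightarrow> quat \<Rightarrow> quat" where
  "quat_mult = (\<lambda>(a, b) (c, d). (a * c - cnj d * b, d * a + b * cnj c))"

definition octo_mult :: "octo \<Rightarrow> octo \<Rightarrow> octo" where
  "octo_mult = (\<lambda>(a, b) (c, d).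
     (quat_mult a c - quat_mult (quat_cnj d) b, quat_mult d a + quat_mult b (quat_cnj c)))"

definition octo_Re :: "octo \<Rightarrow> real" where
  "octo_Re z = Re (fst (fst z))"

text \<open>
  The identification of \<open>\<real>\<^sup>7\<close> with the purely imaginary Cayley numbers, and the imaginary part
  of a Cayley number as a vector of \<open>\<real>\<^sup>7\<close>.
\<close>

definition octo_of_vec :: "real^7 \<Rightarrow> octo" where
  "octo_of_vec x =
     ((Complex 0 (x $ 1), Complex (x $ 2) (x $ 3)), (Complex (x $ 4) (x $ 5), Complex (x $ 6) (x $ 7)))"

definition octo_Im :: "octo \<Rightarrow> real^7" where
  "octo_Im = (\<lambda>((a, b), (c, d)). vector [Im a, Re b, Im b, Re c, Im c, Re d, Im d])"

lemma UNIV_7: "(UNIV :: 7 set) = {1, 2, 3, 4, 5, 6, 7}"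
proof -
  have "card {1, 2, 3, 4, 5, 6, 7 :: 7} = CARD(7)"
    by simp
  then show ?thesis
    by (metis card_subset_eq finite_code subset_UNIV)
qed

lemma forall_7: "(\<forall>i::7. P i) \<longleftrightarrow> P 1 \<and> P 2 \<and> P 3 \<and> P 4 \<and> P 5 \<and> P 6 \<and> P 7"
  by (metis UNIV_7 UNIV_I empty_iff insert_iff)

lemma sum_7: "sum f (UNIV :: 7 set) = f 1 + f 2 + f 3 + f 4 + f 5 + f 6 + f 7"
  unfolding UNIV_7 by (simp add: ac_simps)

lemma vector_7 [simp]:
  "(vector [a, b, c, d, e, f, g] :: ('a::zero)^7) $ 1 = a"
  "(vector [a, b, c, d, e, f, g] :: 'a^7) $ 2 = b"
  "(vector [a, b, c, d, e, f, g] :: 'a^7) $ 3 = c"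
  "(vector [a, b, c, d, e, f, g] :: 'a^7) $ 4 = d"
  "(vector [a, b, c, d, e, f, g] :: 'a^7) $ 5 = e"
  "(vector [a, b, c, d, e, f, g] :: 'a^7) $ 6 = f"
  "(vector [a, b, c, d, e, f, g] :: 'a^7) $ 7 = g"
  unfolding vector_def by simp_all

lemma octo_Im_octo_of_vec: "octo_Im (octo_of_vec x) = x"
  by (simp add: octo_Im_def octo_of_vec_def vec_eq_iff forall_7)

lemma octo_of_vec_octo_Im: "octo_Re z = 0 \<Longrightarrow> octo_of_vec (octo_Im z) = z"
  by (cases z) (auto simp: octo_Im_def octo_of_vec_def octo_Re_def complex_eq_iff)

lemma inner_eq_octo_mult: "x \<bullet> y = - octo_Re (octo_mult (octo_of_vec x) (octo_of_vec y))"
  by (simp add: octo_Re_def octo_mult_def octo_of_vec_def quat_mult_def quat_cnj_def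
      inner_vec_def sum_7)

lemma norm_octo_mult: "norm (octo_mult x y) = norm x * norm y"
proof -
  have "(norm (octo_mult x y))\<^sup>2 = (norm x * norm y)\<^sup>2"
    by (cases x; cases y)
      (auto simp: power2_norm_eq_inner inner_prod_def inner_complex_def octo_mult_def quat_mult_def
        quat_cnj_def power_mult_distrib algebra_simps)
  then show ?thesis
    by simp
qed


section \<open>The round six-sphere and its twistor space\<close>

abbreviation S6 :: "(real^7) set" where
  "S6 \<equiv> sphere 0 1"

definition tangent :: "real^7 \<Rightarrow> (real^7) set" where
  "tangent x = {v. v \<bullet> x = 0}"

definition cayley_J :: "real^7 \<Rightarrow> real^7 \<Rightarrow> real^7" where
  "cayley_J x y = octo_Im (octo_mult (octo_of_vec y) (octo_of_vec x))"

lemma octo_of_vec_cayley_J: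
  assumes "y \<in> tangent x"
  shows "octo_of_vec (cayley_J x y) = octo_mult (octo_of_vec y) (octo_of_vec x)"
  using assms inner_eq_octo_mult[of y x]
  by (simp add: cayley_J_def octo_of_vec_octo_Im tangent_def)

text \<open>
  An orientation of \<open>\<real>\<^sup>7\<close> is encoded by a sign \<open>\<epsilon>\<close>: a basis is positive if \<open>\<epsilon>\<close> times its determinant
  is positive. It induces an orientation of the sphere by the outward normal convention: a basis
  \<open>w\<^sub>1, \<dots>, w\<^sub>6\<close> of the tangent space at \<open>x\<close> is positive if \<open>x, w\<^sub>1, \<dots>, w\<^sub>6\<close> is. A complex structure
  \<open>J\<close> on the tangent space induces the orientation for which all bases of the form
  \<open>v\<^sub>1, J v\<^sub>1, v\<^sub>2, J v\<^sub>2, v\<^sub>3, J v\<^sub>3\<close> are positive.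
\<close>

definition complex_frame ::
    "real^7 \<Rightarrow> (real^7 \<Rightarrow> real^7) \<Rightarrow> real^7 \<Rightarrow> real^7 \<Rightarrow> real^7 \<Rightarrow> real^7^7" where
  "complex_frame x J v1 v2 v3 = vector [x, v1, J v1, v2, J v2, v3, J v3]"

definition induces_orientation :: "real \<Rightarrow> real^7 \<Rightarrow> (real^7 \<Rightarrow> real^7) \<Rightarrow> bool" where
  "induces_orientation \<epsilon> x J \<longleftrightarrow>
     (\<forall>v1 \<in> tangent x. \<forall>v2 \<in> tangent x. \<forall>v3 \<in> tangent x.
        det (complex_frame x J v1 v2 v3) \<noteq> 0 \<longrightarrow> \<epsilon> * det (complex_frame x J v1 v2 v3) > 0)"

definition cayley_orientation :: real where
  "cayley_orientation =
     (THE \<epsilon>. (\<epsilon> = 1 \<or> \<epsilon> = - 1) \<and> (\<forall>x \<in> S6. induces_orientation \<epsilon> x (cayley_J x)))"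

text \<open>
  An endomorphism of the tangent space at \<open>x\<close> is represented by its extension to \<open>\<real>\<^sup>7\<close> that is zero
  on the normal line spanned by \<open>x\<close>. Thus equality of complex structures is equality of functions,
  and the twistor space becomes a submanifold of \<open>S\<^sup>6 \<times> End(\<real>\<^sup>7)\<close>, with projection \<open>fst\<close>.
\<close>

definition twistor_space :: "((real^7) \<times> (real^7 \<Rightarrow> real^7)) set" where
  "twistor_space = {(x, J). x \<in> S6 \<and> linear J \<and> J x = 0 \<and>
     (\<forall>v \<in> tangent x. J v \<in> tangent x \<and> J (J v) = - v) \<and>
     (\<forall>v \<in> tangent x. \<forall>w \<in> tangent x. J v \<bullet> J w = v \<bullet> w) \<and>
     induces_orientation cayley_orientation x J}"


section \<open>Smooth maps on the sphere\<close>

text \<open>\<open>C\<^sup>k\<close> maps; only meaningful on open sets of a finite-dimensional space.\<close>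

primrec C_k_on ::
    "nat \<Rightarrow> 'a::euclidean_space set \<Rightarrow> ('a \<Rightarrow> 'b::real_normed_vector) \<Rightarrow> bool" where
  "C_k_on 0 U f \<longleftrightarrow> continuous_on U f"
| "C_k_on (Suc k) U f \<longleftrightarrow>
     (\<forall>x \<in> U. f differentiable (at x)) \<and> (\<forall>v. C_k_on k U (\<lambda>x. frechet_derivative f (at x) v))"

definition smooth_on :: "'a::euclidean_space set \<Rightarrow> ('a \<Rightarrow> 'b::real_normed_vector) \<Rightarrow> bool" where
  "smooth_on U f \<longleftrightarrow> (\<forall>k. C_k_on k U f)"

definition smooth_S6 :: "(real^7 \<Rightarrow> 'b::real_normed_vector) \<Rightarrow> bool" where
  "smooth_S6 f \<longleftrightarrow>
     (\<forall>p \<in> S6. \<exists>U g. open U \<and> p \<in> U \<and> smooth_on U g \<and> (\<forall>x \<in> U \<inter> S6. g x = f x))"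

definition vector_field :: "(real^7 \<Rightarrow> real^7) \<Rightarrow> bool" where
  "vector_field X \<longleftrightarrow> smooth_S6 X \<and> (\<forall>x \<in> S6. X x \<in> tangent x)"

definition smooth_section :: "(real^7 \<Rightarrow> real^7 \<Rightarrow> real^7) \<Rightarrow> bool" where
  "smooth_section I \<longleftrightarrow> (\<forall>x \<in> S6. (x, I x) \<in> twistor_space) \<and> smooth_S6 (\<lambda>x. matrix (I x))"


section \<open>The Levi-Civita connection and nearly Kaehler structures\<close>

text \<open>
  The differential at \<open>x \<in> S\<^sup>6\<close>, applied to a tangent vector \<open>v\<close>, of a map \<open>f\<close> given on the sphere:
  \<open>f\<close> is precomposed with the radial retraction, whose derivative at \<open>x\<close> is the identity on the
  tangent space. Values of \<open>f\<close> outside of the sphere are irrelevant.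
\<close>

definition sphere_deriv ::
    "(real^7 \<Rightarrow> 'b::real_normed_vector) \<Rightarrow> real^7 \<Rightarrow> real^7 \<Rightarrow> 'b" where
  "sphere_deriv f x v = frechet_derivative (\<lambda>y. f (y /\<^sub>R norm y)) (at x) v"

text \<open>
  The Lie bracket of two vector fields on the sphere, both regarded as \<open>\<real>\<^sup>7\<close>-valued functions.
\<close>

definition lie_bracket :: "(real^7 \<Rightarrow> real^7) \<Rightarrow> (real^7 \<Rightarrow> real^7) \<Rightarrow> real^7 \<Rightarrow> real^7" where
  "lie_bracket X Y x = sphere_deriv Y x (X x) - sphere_deriv X x (Y x)"

definition affine_connection ::
    "((real^7 \<Rightarrow> real^7) \<Rightarrow> (real^7 \<Rightarrow> real^7) \<Rightarrow> real^7 \<Rightarrow> real^7) \<Rightarrow> bool" where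
  "affine_connection D \<longleftrightarrow>
     (\<forall>X Y. vector_field X \<longrightarrow> vector_field Y \<longrightarrow> vector_field (D X Y)) \<and>
     (\<forall>X X' Y. vector_field X \<longrightarrow> vector_field X' \<longrightarrow> vector_field Y \<longrightarrow>
        (\<forall>x \<in> S6. D (\<lambda>y. X y + X' y) Y x = D X Y x + D X' Y x)) \<and>
     (\<forall>X Y Y'. vector_field X \<longrightarrow> vector_field Y \<longrightarrow> vector_field Y' \<longrightarrow>
        (\<forall>x \<in> S6. D X (\<lambda>y. Y y + Y' y) x = D X Y x + D X Y' x)) \<and>
     (\<forall>f X Y. smooth_S6 f \<longrightarrow> vector_field X \<longrightarrow> vector_field Y \<longrightarrow>
        (\<forall>x \<in> S6. D (\<lambda>y. f y *\<^sub>R X y) Y x = f x *\<^sub>R D X Y x)) \<and>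
     (\<forall>f X Y. smooth_S6 f \<longrightarrow> vector_field X \<longrightarrow> vector_field Y \<longrightarrow>
        (\<forall>x \<in> S6. D X (\<lambda>y. f y *\<^sub>R Y y) x = sphere_deriv f x (X x) *\<^sub>R Y x + f x *\<^sub>R D X Y x))"

definition levi_civita ::
    "((real^7 \<Rightarrow> real^7) \<Rightarrow> (real^7 \<Rightarrow> real^7) \<Rightarrow> real^7 \<Rightarrow> real^7) \<Rightarrow> bool" where
  "levi_civita D \<longleftrightarrow> affine_connection D \<and>
     (\<forall>X Y Z. vector_field X \<longrightarrow> vector_field Y \<longrightarrow> vector_field Z \<longrightarrow>
        (\<forall>x \<in> S6. sphere_deriv (\<lambda>y. Y y \<bullet> Z y) x (X x) = D X Y x \<bullet> Z x + Y x \<bullet> D X Z x)) \<and>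
     (\<forall>X Y. vector_field X \<longrightarrow> vector_field Y \<longrightarrow>
        (\<forall>x \<in> S6. D X Y x - D Y X x = lie_bracket X Y x))"

text \<open>
  \<open>(g\<^sub>0, I)\<close> is nearly Kaehler, for \<open>I\<close> an almost complex structure on the sphere. The value at \<open>x\<close> of
  \<open>(\<nabla>\<^sub>X I) X = \<nabla>\<^sub>X (I X) - I (\<nabla>\<^sub>X X)\<close> depends only on the tangent vector \<open>X x\<close>, and every tangent
  vector is the value of a vector field. The Levi-Civita connection exists and is unique, as proved
  below.
\<close>

definition nearly_kaehler :: "(real^7 \<Rightarrow> real^7 \<Rightarrow> real^7) \<Rightarrow> bool" where
  "nearly_kaehler I \<longleftrightarrow>
     (\<exists>D. levi_civita D \<and>
        (\<forall>X. vector_field X \<longrightarrow>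
           (\<forall>x \<in> S6. D X (\<lambda>y. I y (X y)) x - I x (D X X x) = 0)))"


definition one_parameter_family ::
    "real set \<Rightarrow> (real \<Rightarrow> real^7 \<Rightarrow> real^7 \<Rightarrow> real^7) \<Rightarrow> bool" where
  "one_parameter_family T I \<longleftrightarrow>
     is_interval T \<and> (\<exists>a \<in> T. \<exists>b \<in> T. a < b) \<and>
     (\<forall>s \<in> T. \<forall>t \<in> T. s \<noteq> t \<longrightarrow> (\<exists>x \<in> S6. I s x \<noteq> I t x))"

end

theory Submission
  imports Defs
begin

text \<open>
  For a rotation \<open>A \<in> SO(7)\<close>, conjugating the Cayley almost complex structure \<open>\<J>\<close> by \<open>A\<close> gives the
  nearly Kaehler structure \<open>I\<^bsub>x\<^esub> = A\<^sup>T \<J>\<^bsub>A x\<^esub> A\<close>. Mapping a unitary frame of the tangent space at \<open>p\<close>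
  to one at \<open>e\<^sub>1\<close> yields a rotation \<open>A\<close> with \<open>I\<^bsub>p\<^esub> = J\<^bsub>p\<^esub>\<close>. This \<open>A\<close> may still be multiplied by
  elements of the stabilizer \<open>U(3)\<close> of \<open>\<J>\<close> at \<open>e\<^sub>1\<close>, of which only the subgroup \<open>SU(3)\<close>, its
  intersection with \<open>G\<^sub>2\<close>, preserves \<open>\<J>\<close> everywhere: the rotations of the complex line spanned by
  \<open>e\<^sub>2\<close> and \<open>e\<^sub>3\<close> give the family.
\<close>

section \<open>Smooth maps\<close>

lemma frechet_derivative_eqI:
  "(f has_derivative f') (at x) \<Longrightarrow> frechet_derivative f (at x) = f'"
  by (metis frechet_derivative_at)

text \<open>On an open set the derivative at a point depends only on values inside the set, so
  agreement on \<open>U\<close> passes to all iterated derivatives even if \<open>f\<close> and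
  \<open>g\<close> differ elsewhere.\<close>

lemma C_k_on_cong:
  assumes "open U" "\<And>x. x \<in> U \<Longrightarrow> f x = g x" "C_k_on k U f"
  shows "C_k_on k U g"
  using assms(2,3)
proof (induction k arbitrary: f g)
  case 0
  then show ?case
    by (simp cong: continuous_on_cong)
next
  case (Suc k)
  have g: "(g has_derivative frechet_derivative f (at x)) (at x)" if "x \<in> U" for x
    using Suc.prems that assms(1)
    by (auto intro: has_derivative_transform_within_open simp: frechet_derivative_works)
  show ?case
    unfolding C_k_on.simps
  proof (intro conjI ballI allI)
    show "g differentiable (at x)" if "x \<in> U" for x
      using g[OF that] differentiableI by blast
    show "C_k_on k U (\<lambda>x. frechet_derivative g (at x) v)" for v
      by (rule Suc.IH[of "\<lambda>x. frechet_derivative f (at x) v"])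
        (use Suc.prems frechet_derivative_eqI[OF g] in auto)
  qed
qed

lemma C_k_on_SucI:
  assumes "open U" "\<And>x. x \<in> U \<Longrightarrow> (f has_derivative f' x) (at x)"
    and "\<And>v. C_k_on k U (\<lambda>x. f' x v)"
  shows "C_k_on (Suc k) U f"
  unfolding C_k_on.simps
proof (intro conjI ballI allI)
  show "f differentiable (at x)" if "x \<in> U" for x
    using assms(2)[OF that] differentiableI by blast
  show "C_k_on k U (\<lambda>x. frechet_derivative f (at x) v)" for v
    by (rule C_k_on_cong[OF assms(1) _ assms(3)]) (simp add: frechet_derivative_eqI[OF assms(2)])
qed

text \<open>The recursion mentions continuity only at order 0, so the lower orders have to be
  recovered by induction from differentiability. The Leibniz rule needs this because its terms
  contain undifferentiated factors.\<close>

lemma C_k_on_SucD: "C_k_on (Suc k) U f \<Longrightarrow> C_k_on k U f"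
proof (induction k arbitrary: f)
  case 0
  then show ?case
    by (auto intro!: continuous_at_imp_continuous_on differentiable_imp_continuous_within)
next
  case (Suc k)
  note * = C_k_on.simps(2)[THEN iffD1, OF Suc.prems]
  show ?case
    by (rule C_k_on.simps(2)[THEN iffD2], intro conjI allI)
      (rule conjunct1[OF *], rule Suc.IH, rule spec[OF conjunct2[OF *]])
qed

lemma C_k_on_subset: "C_k_on k U f \<Longrightarrow> V \<subseteq> U \<Longrightarrow> C_k_on k V f"
  by (induction k arbitrary: f) (auto intro: continuous_on_subset)

lemma C_k_on_const: "open U \<Longrightarrow> C_k_on k U (\<lambda>x. c)"
  by (induction k arbitrary: c) (auto intro!: C_k_on_SucI[where f' = "\<lambda>x v. 0"])

lemma C_k_on_bounded_linear:
  assumes "open U" "bounded_linear f"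
  shows "C_k_on k U f"
proof (cases k)
  case 0
  then show ?thesis
    using assms by (simp add: linear_continuous_on)
next
  case (Suc j)
  show ?thesis
    unfolding Suc
    by (rule C_k_on_SucI[where f' = "\<lambda>x. f"])
      (use assms in \<open>auto intro: C_k_on_const bounded_linear_imp_has_derivative\<close>)
qed

lemma C_k_on_add:
  assumes "open U" "C_k_on k U f" "C_k_on k U g"
  shows "C_k_on k U (\<lambda>x. f x + g x)"
  using assms(2,3)
proof (induction k arbitrary: f g)
  case 0
  then show ?case by (auto intro: continuous_intros)
next
  case (Suc k)
  show ?case
    by (rule C_k_on_SucI[OF assms(1),
          where f' = "\<lambda>x v. frechet_derivative f (at x) v + frechet_derivative g (at x) v"])
      (use Suc in \<open>auto intro!: has_derivative_add simp: frechet_derivative_works\<close>)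
qed

text \<open>Both terms of the Leibniz rule are again of the form \<open>m (f x) (g x)\<close>, so
  the induction closes with \<open>f\<close> and \<open>g\<close> arbitrary. The bilinear form
  covers scalar multiples and inner products at once.\<close>

lemma C_k_on_bilinear:
  assumes "bounded_bilinear m" "open U" "C_k_on k U f" "C_k_on k U g"
  shows "C_k_on k U (\<lambda>x. m (f x) (g x))"
  using assms(3,4)
proof (induction k arbitrary: f g)
  case 0
  then show ?case using bounded_bilinear.continuous_on[OF assms(1)] by auto
next
  case (Suc k)
  have "C_k_on k U f" "C_k_on k U g"
    using Suc.prems C_k_on_SucD by blast+
  then show ?case
    by (intro C_k_on_SucI[OF assms(2),
          where f' = "\<lambda>x v. m (f x) (frechet_derivative g (at x) v) +
                           m (frechet_derivative f (at x) v) (g x)"]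
        bounded_bilinear.FDERIV[OF assms(1)] C_k_on_add[OF assms(2)] Suc.IH)
      (use Suc.prems in \<open>auto simp: frechet_derivative_works\<close>)
qed

lemma smooth_on_frechet_derivative:
  assumes "smooth_on U f"
  shows "smooth_on U (\<lambda>x. frechet_derivative f (at x) v)"
  unfolding smooth_on_def
proof
  fix k
  have "C_k_on (Suc k) U f" using assms by (simp only: smooth_on_def)
  then show "C_k_on k U (\<lambda>x. frechet_derivative f (at x) v)" by simp
qed

lemma smooth_on_add: "open U \<Longrightarrow> smooth_on U f \<Longrightarrow> smooth_on U g \<Longrightarrow> smooth_on U (\<lambda>x. f x + g x)"
  unfolding smooth_on_def by (blast intro: C_k_on_add)

lemma smooth_on_bilinear:
  "bounded_bilinear m \<Longrightarrow> open U \<Longrightarrow> smooth_on U f \<Longrightarrow> smooth_on U g \<Longrightarrow>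
    smooth_on U (\<lambda>x. m (f x) (g x))"
  unfolding smooth_on_def by (blast intro: C_k_on_bilinear)

lemma smooth_on_bounded_linear: "open U \<Longrightarrow> bounded_linear f \<Longrightarrow> smooth_on U f"
  unfolding smooth_on_def by (blast intro: C_k_on_bounded_linear)

lemma smooth_on_const: "open U \<Longrightarrow> smooth_on U (\<lambda>x. c)"
  unfolding smooth_on_def by (blast intro: C_k_on_const)

lemma smooth_on_subset: "smooth_on U f \<Longrightarrow> V \<subseteq> U \<Longrightarrow> smooth_on V f"
  unfolding smooth_on_def by (blast intro: C_k_on_subset)

lemma smooth_on_sum:
  assumes "open U" "finite B" "\<And>b. b \<in> B \<Longrightarrow> smooth_on U (f b)"
  shows "smooth_on U (\<lambda>x. \<Sum>b\<in>B. f b x)"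
  using assms(2,3)
proof (induction B)
  case empty
  then show ?case using assms(1) by (simp add: smooth_on_const)
next
  case (insert b B)
  then show ?case using assms(1) by (simp add: smooth_on_add)
qed

lemma smooth_on_differentiable: "smooth_on U f \<Longrightarrow> x \<in> U \<Longrightarrow> f differentiable (at x)"
  unfolding smooth_on_def by (metis C_k_on.simps(2))

section \<open>The Levi-Civita connection of the round sphere\<close>

lemma smooth_S6_E:
  assumes "smooth_S6 f" "p \<in> S6"
  obtains U g where "open U" "p \<in> U" "smooth_on U g" "\<And>x. x \<in> U \<Longrightarrow> x \<in> S6 \<Longrightarrow> g x = f x"
proof -
  obtain U g where "open U" "p \<in> U" "smooth_on U g" "\<forall>x\<in>U \<inter> S6. g x = f x"
    using assms(1)[unfolded smooth_S6_def, rule_format, OF assms(2)] by (elim exE conjE)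
  then show thesis by (intro that[of U g]) auto
qed

lemma smooth_S6_bounded_linear: "bounded_linear f \<Longrightarrow> smooth_S6 f"
  unfolding smooth_S6_def by (auto intro!: exI[of _ UNIV] exI[of _ f] smooth_on_bounded_linear)

lemma smooth_S6_add:
  assumes "smooth_S6 f" "smooth_S6 g"
  shows "smooth_S6 (\<lambda>x. f x + g x)"
  unfolding smooth_S6_def
proof
  fix p :: "real^7" assume p: "p \<in> S6"
  obtain U f' where f':
    "open U" "p \<in> U" "smooth_on U f'" "\<And>x. x \<in> U \<Longrightarrow> x \<in> S6 \<Longrightarrow> f' x = f x"
    using smooth_S6_E[OF assms(1) p] by blast
  obtain V g' where g':
    "open V" "p \<in> V" "smooth_on V g'" "\<And>x. x \<in> V \<Longrightarrow> x \<in> S6 \<Longrightarrow> g' x = g x"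
    using smooth_S6_E[OF assms(2) p] by blast
  have "smooth_on (U \<inter> V) f'" "smooth_on (U \<inter> V) g'"
    using smooth_on_subset[OF f'(3), of "U \<inter> V"] smooth_on_subset[OF g'(3), of "U \<inter> V"] by auto
  with f' g' show "\<exists>U h. open U \<and> p \<in> U \<and> smooth_on U h \<and> (\<forall>x\<in>U \<inter> S6. h x = f x + g x)"
    by (intro exI[of _ "U \<inter> V"] exI[of _ "\<lambda>x. f' x + g' x"])
      (auto intro!: smooth_on_add)
qed

lemma smooth_S6_bilinear:
  assumes "bounded_bilinear m" "smooth_S6 f" "smooth_S6 g"
  shows "smooth_S6 (\<lambda>x. m (f x) (g x))"
  unfolding smooth_S6_def
proof
  fix p :: "real^7" assume p: "p \<in> S6"
  obtain U f' where f':
    "open U" "p \<in> U" "smooth_on U f'" "\<And>x. x \<in> U \<Longrightarrow> x \<in> S6 \<Longrightarrow> f' x = f x"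
    using smooth_S6_E[OF assms(2) p] by blast
  obtain V g' where g':
    "open V" "p \<in> V" "smooth_on V g'" "\<And>x. x \<in> V \<Longrightarrow> x \<in> S6 \<Longrightarrow> g' x = g x"
    using smooth_S6_E[OF assms(3) p] by blast
  have "smooth_on (U \<inter> V) f'" "smooth_on (U \<inter> V) g'"
    using smooth_on_subset[OF f'(3), of "U \<inter> V"] smooth_on_subset[OF g'(3), of "U \<inter> V"] by auto
  with f' g' show "\<exists>U h. open U \<and> p \<in> U \<and> smooth_on U h \<and> (\<forall>x\<in>U \<inter> S6. h x = m (f x) (g x))"
    by (intro exI[of _ "U \<inter> V"] exI[of _ "\<lambda>x. m (f' x) (g' x)"])
      (auto intro!: smooth_on_bilinear[OF assms(1)])
qed

section \<open>Differentials of functions on the sphere\<close>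

lemma has_derivative_radial_retraction:
  fixes x :: "'a::real_inner"
  assumes "norm x = 1"
  shows "((\<lambda>y. y /\<^sub>R norm y) has_derivative (\<lambda>v. v - (v \<bullet> x) *\<^sub>R x)) (at x)"
proof -
  have "x \<noteq> 0" using assms by auto
  then have "(norm has_derivative (\<lambda>v. v \<bullet> x)) (at x)"
    using has_derivative_norm[of x] assms by (simp add: sgn_div_norm)
  with \<open>x \<noteq> 0\<close> assms show ?thesis
    by (auto intro!: derivative_eq_intros simp: fun_eq_iff)
qed

text \<open>The chain rule for \<open>g\<close> after the radial retraction, whose differential is
  the orthogonal projection onto the tangent space. Near \<open>x\<close> the retraction takes
  values in \<open>U\<close> and in the sphere, so there \<open>g\<close> may be replaced by
  \<open>f\<close>.\<close>

lemma sphere_deriv_extension: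
  assumes "open U" "x \<in> U" "smooth_on U g" "\<And>y. y \<in> U \<Longrightarrow> y \<in> S6 \<Longrightarrow> g y = f y" and x: "x \<in> S6"
  shows "((\<lambda>y. f (y /\<^sub>R norm y)) has_derivative
           (\<lambda>v. frechet_derivative g (at x) (v - (v \<bullet> x) *\<^sub>R x))) (at x)"
proof -
  let ?r = "\<lambda>y::real^7. y /\<^sub>R norm y"
  have "x \<noteq> 0" and [simp]: "norm x = 1" "?r x = x" using x by auto
  have r: "(?r has_derivative (\<lambda>v. v - (v \<bullet> x) *\<^sub>R x)) (at x)"
    by (rule has_derivative_radial_retraction) simp
  have "(g has_derivative frechet_derivative g (at x)) (at (?r x))"
    using smooth_on_differentiable[OF assms(3,2)] by (simp add: frechet_derivative_works)
  from has_derivative_compose[OF r this]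
  have d: "((\<lambda>y. g (?r y)) has_derivative
      (\<lambda>v. frechet_derivative g (at x) (v - (v \<bullet> x) *\<^sub>R x))) (at x)" .
  have "(?r \<longlongrightarrow> ?r x) (at x)"
    using has_derivative_continuous[OF r] by (simp add: continuous_within)
  then have "\<forall>\<^sub>F y in at x. ?r y \<in> U"
    using assms(1,2) by (simp add: tendsto_def)
  moreover have "\<forall>\<^sub>F y in at x. y \<noteq> 0"
    by (rule tendsto_imp_eventually_ne[OF tendsto_ident_at]) (rule \<open>x \<noteq> 0\<close>)
  ultimately have "\<forall>\<^sub>F y in at x. g (?r y) = f (?r y)"
    by eventually_elim (use assms(4) in auto)
  then show ?thesis
    by (rule has_derivative_transform_eventually[OF d]) (use assms x in auto)
qed

lemma sphere_deriv_tangent_extension: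
  assumes "open U" "x \<in> U" "smooth_on U g" "\<And>y. y \<in> U \<Longrightarrow> y \<in> S6 \<Longrightarrow> g y = f y" "x \<in> S6"
    and "v \<in> tangent x"
  shows "sphere_deriv f x v = frechet_derivative g (at x) v"
  using frechet_derivative_eqI[OF sphere_deriv_extension[OF assms(1-5)]] assms(6)
  by (simp add: sphere_deriv_def tangent_def)

lemma sphere_deriv_works:
  assumes "smooth_S6 f" "x \<in> S6"
  shows "((\<lambda>y. f (y /\<^sub>R norm y)) has_derivative sphere_deriv f x) (at x)"
proof -
  obtain U g where "open U" "x \<in> U" "smooth_on U g" "\<And>y. y \<in> U \<Longrightarrow> y \<in> S6 \<Longrightarrow> g y = f y"
    using smooth_S6_E[OF assms] by blast
  from sphere_deriv_extension[OF this assms(2)] show ?thesis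
    by (simp add: sphere_deriv_def[abs_def] frechet_derivative_eqI)
qed

lemma sphere_deriv_linear: "smooth_S6 f \<Longrightarrow> x \<in> S6 \<Longrightarrow> linear (sphere_deriv f x)"
  using sphere_deriv_works has_derivative_linear by blast

lemma sphere_deriv_add:
  assumes "smooth_S6 f" "smooth_S6 g" "x \<in> S6"
  shows "sphere_deriv (\<lambda>y. f y + g y) x v = sphere_deriv f x v + sphere_deriv g x v"
  using frechet_derivative_eqI[OF has_derivative_add[OF assms(1,2)[THEN sphere_deriv_works, OF assms(3)]]]
  by (simp add: sphere_deriv_def)

lemma sphere_deriv_bilinear:
  assumes "bounded_bilinear m" "smooth_S6 f" "smooth_S6 g" "x \<in> S6"
  shows "sphere_deriv (\<lambda>y. m (f y) (g y)) x v =
    m (f x) (sphere_deriv g x v) + m (sphere_deriv f x v) (g x)"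
  using frechet_derivative_eqI[OF bounded_bilinear.FDERIV[OF assms(1)
      assms(2,3)[THEN sphere_deriv_works, OF assms(4)]]] assms(4)
  by (simp add: sphere_deriv_def)

lemma sphere_deriv_bounded_linear:
  assumes "bounded_linear f" "x \<in> S6" "v \<in> tangent x"
  shows "sphere_deriv f x v = f v"
  using sphere_deriv_tangent_extension[OF open_UNIV UNIV_I
      smooth_on_bounded_linear[OF open_UNIV assms(1)] _ assms(2,3)]
    frechet_derivative_eqI[OF bounded_linear_imp_has_derivative[OF assms(1)]]
  by simp

text \<open>Differentiating the identity \<open>Y y \<bullet> y = 0\<close> along the sphere gives
  the normal component of the ambient derivative of a tangent field.\<close>

lemma sphere_deriv_inner_self:
  assumes "vector_field Y" "x \<in> S6" "v \<in> tangent x"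
  shows "sphere_deriv Y x v \<bullet> x = - (v \<bullet> Y x)"
proof -
  have Y: "smooth_S6 Y" and tan: "\<And>y. y \<in> S6 \<Longrightarrow> Y y \<bullet> y = 0"
    using assms(1) by (auto simp: vector_field_def tangent_def)
  have "x \<noteq> 0" using assms(2) by auto
  have "sphere_deriv (\<lambda>y. Y y \<bullet> y) x v = Y x \<bullet> v + sphere_deriv Y x v \<bullet> x"
    using sphere_deriv_bilinear[OF bounded_bilinear_inner Y
        smooth_S6_bounded_linear[OF bounded_linear_ident] assms(2)]
      sphere_deriv_bounded_linear[OF bounded_linear_ident assms(2,3)] by simp
  \<comment> \<open>After retraction the product vanishes identically away from the origin, hence on
    a neighbourhood of \<open>x\<close>.\<close>
  moreover have "((\<lambda>y. Y (y /\<^sub>R norm y) \<bullet> (y /\<^sub>R norm y)) has_derivative (\<lambda>v. 0)) (at x)"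
    by (rule has_derivative_transform_within_open[OF has_derivative_const[of 0], of "- {0}"])
      (use \<open>x \<noteq> 0\<close> tan in \<open>auto simp del: inner_scaleR_right\<close>)
  then have "sphere_deriv (\<lambda>y. Y y \<bullet> y) x v = 0"
    unfolding sphere_deriv_def by (simp add: frechet_derivative_eqI)
  ultimately show ?thesis by (simp add: inner_commute)
qed

text \<open>The Gauss formula: the normal component of the ambient derivative is
  \<open>- (X x \<bullet> Y x)\<close>, so the second summand removes it and leaves the tangential
  projection.\<close>

definition round_connection ::
    "(real^7 \<Rightarrow> real^7) \<Rightarrow> (real^7 \<Rightarrow> real^7) \<Rightarrow> real^7 \<Rightarrow> real^7" where
  "round_connection X Y x = sphere_deriv Y x (X x) + (X x \<bullet> Y x) *\<^sub>R x"

lemma vector_field_round_connection: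
  assumes X: "vector_field X" and Y: "vector_field Y"
  shows "vector_field (round_connection X Y)"
proof -
  have "smooth_S6 (\<lambda>x. sphere_deriv Y x (X x))"
    unfolding smooth_S6_def
  proof
    fix p :: "real^7" assume p: "p \<in> S6"
    have sm: "smooth_S6 X" "smooth_S6 Y" using X Y by (auto simp: vector_field_def)
    obtain U X' where U: "open U" "p \<in> U" "smooth_on U X'" "\<And>x. x \<in> U \<Longrightarrow> x \<in> S6 \<Longrightarrow> X' x = X x"
      using smooth_S6_E[OF sm(1) p] by blast
    obtain V Y' where V: "open V" "p \<in> V" "smooth_on V Y'" "\<And>x. x \<in> V \<Longrightarrow> x \<in> S6 \<Longrightarrow> Y' x = Y x"
      using smooth_S6_E[OF sm(2) p] by blast
    \<comment> \<open>The direction of differentiation varies with the point. Expanding it in the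
      standard basis leaves derivatives in constant directions, which are smooth, multiplied by
      smooth coefficients.\<close>
    let ?h = "\<lambda>x. \<Sum>b\<in>Basis. (X' x \<bullet> b) *\<^sub>R frechet_derivative Y' (at x) b"
    have "smooth_on (U \<inter> V) (\<lambda>x. X' x \<bullet> b)" for b
      by (rule smooth_on_bilinear[OF bounded_bilinear_inner])
        (use U V smooth_on_subset[OF U(3), of "U \<inter> V"] in \<open>auto intro: smooth_on_const\<close>)
    moreover have "smooth_on (U \<inter> V) (\<lambda>x. frechet_derivative Y' (at x) b)" for b
      using smooth_on_subset[OF smooth_on_frechet_derivative[OF V(3)], of "U \<inter> V"] by blast
    ultimately have "smooth_on (U \<inter> V) ?h"
      using U(1) V(1) by (intro smooth_on_sum smooth_on_bilinear[OF bounded_bilinear_scaleR]) auto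
    moreover have "?h x = sphere_deriv Y x (X x)" if x: "x \<in> U \<inter> V" "x \<in> S6" for x
    proof -
      have "linear (frechet_derivative Y' (at x))"
        using smooth_on_differentiable[OF V(3)] x linear_frechet_derivative by blast
      then have "?h x = frechet_derivative Y' (at x) (\<Sum>b\<in>Basis. (X' x \<bullet> b) *\<^sub>R b)"
        by (simp add: linear_sum linear_scale)
      also have "\<dots> = frechet_derivative Y' (at x) (X x)"
        using U(4) x by (simp add: euclidean_representation)
      also have "\<dots> = sphere_deriv Y x (X x)"
        using sphere_deriv_tangent_extension[OF V(1) _ V(3,4), of x "X x"] x X
        by (simp add: vector_field_def)
      finally show ?thesis .
    qed
    ultimately show "\<exists>U h. open U \<and> p \<in> U \<and> smooth_on U h \<and>
        (\<forall>x\<in>U \<inter> S6. h x = sphere_deriv Y x (X x))"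
      using U V by (intro exI[of _ "U \<inter> V"] exI[of _ ?h]) auto
  qed
  moreover have "smooth_S6 (\<lambda>x. (X x \<bullet> Y x) *\<^sub>R x)"
    using X Y by (intro smooth_S6_bilinear[OF bounded_bilinear_scaleR]
        smooth_S6_bilinear[OF bounded_bilinear_inner])
      (auto simp: vector_field_def intro: smooth_S6_bounded_linear bounded_linear_ident)
  ultimately have "smooth_S6 (round_connection X Y)"
    unfolding round_connection_def[abs_def] by (rule smooth_S6_add)
  moreover have "round_connection X Y x \<in> tangent x" if "x \<in> S6" for x
    using sphere_deriv_inner_self[OF Y that, of "X x"] X that
    by (simp add: round_connection_def vector_field_def tangent_def inner_add_left dot_square_norm)
  ultimately show ?thesis
    by (simp add: vector_field_def)
qed

text \<open>The correction term is normal, so it disappears from inner products with tangent fields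
  and compatibility with the metric is the ordinary product rule. It is symmetric in
  \<open>X\<close> and \<open>Y\<close>, so it cancels in the torsion.\<close>

lemma levi_civita_round_connection: "levi_civita round_connection"
  unfolding levi_civita_def affine_connection_def
proof (intro conjI allI impI ballI)
  fix X Y :: "real^7 \<Rightarrow> real^7" assume "vector_field X" "vector_field Y"
  then show "vector_field (round_connection X Y)"
    by (rule vector_field_round_connection)
next
  fix X X' Y :: "real^7 \<Rightarrow> real^7" and x
  assume "vector_field X" "vector_field X'" "vector_field Y" "x \<in> S6"
  then show "round_connection (\<lambda>y. X y + X' y) Y x = round_connection X Y x + round_connection X' Y x"
    using sphere_deriv_linear[of Y x]
    by (simp add: round_connection_def vector_field_def linear_add algebra_simps)
next
  fix X Y Y' :: "real^7 \<Rightarrow> real^7" and x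
  assume "vector_field X" "vector_field Y" "vector_field Y'" "x \<in> S6"
  then show "round_connection X (\<lambda>y. Y y + Y' y) x = round_connection X Y x + round_connection X Y' x"
    by (simp add: round_connection_def vector_field_def sphere_deriv_add algebra_simps)
next
  fix f :: "real^7 \<Rightarrow> real" and X Y :: "real^7 \<Rightarrow> real^7" and x
  assume "smooth_S6 f" "vector_field X" "vector_field Y" "x \<in> S6"
  then show "round_connection (\<lambda>y. f y *\<^sub>R X y) Y x = f x *\<^sub>R round_connection X Y x"
    using sphere_deriv_linear[of Y x]
    by (simp add: round_connection_def vector_field_def linear_scale algebra_simps)
next
  fix f :: "real^7 \<Rightarrow> real" and X Y :: "real^7 \<Rightarrow> real^7" and x
  assume "smooth_S6 f" "vector_field X" "vector_field Y" "x \<in> S6"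
  then show "round_connection X (\<lambda>y. f y *\<^sub>R Y y) x =
      sphere_deriv f x (X x) *\<^sub>R Y x + f x *\<^sub>R round_connection X Y x"
    by (simp add: round_connection_def vector_field_def
        sphere_deriv_bilinear[OF bounded_bilinear_scaleR] algebra_simps)
next
  fix X Y Z :: "real^7 \<Rightarrow> real^7" and x
  assume "vector_field X" "vector_field Y" "vector_field Z" "x \<in> S6"
  then show "sphere_deriv (\<lambda>y. Y y \<bullet> Z y) x (X x) =
      round_connection X Y x \<bullet> Z x + Y x \<bullet> round_connection X Z x"
    by (simp add: round_connection_def vector_field_def tangent_def
        sphere_deriv_bilinear[OF bounded_bilinear_inner] inner_add_left inner_add_right
        inner_commute[of x])
next
  fix X Y :: "real^7 \<Rightarrow> real^7" and x
  show "round_connection X Y x - round_connection Y X x = lie_bracket X Y x"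
    by (simp add: round_connection_def lie_bracket_def inner_commute)
qed

text \<open>Here \<open>\<nabla>\<^sub>X (I X) - I (\<nabla>\<^sub>X X)\<close> is just \<open>I\<^bsub>X\<^esub> X\<close>, because \<open>I\<close> is bilinear.\<close>

lemma nearly_kaehler_bilinear:
  assumes bil: "bounded_bilinear I" and alt: "\<And>v. I v v = 0"
    and skew: "\<And>x v. v \<bullet> I x v = 0"
  shows "nearly_kaehler I"
  unfolding nearly_kaehler_def
proof (intro exI[of _ round_connection] conjI allI impI ballI levi_civita_round_connection)
  fix X :: "real^7 \<Rightarrow> real^7" and x :: "real^7"
  assume X: "vector_field X" and x: "x \<in> S6"
  have Xs: "smooth_S6 X" "X x \<in> tangent x" using X x by (auto simp: vector_field_def)
  have "sphere_deriv (\<lambda>y. I y (X y)) x (X x) = I x (sphere_deriv X x (X x))"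
    using sphere_deriv_bilinear[OF bil smooth_S6_bounded_linear[OF bounded_linear_ident] Xs(1) x]
      sphere_deriv_bounded_linear[OF bounded_linear_ident x Xs(2)] alt by simp
  \<comment> \<open>The normal corrections drop out as well: \<open>X x \<bullet> I x (X x)\<close>
    vanishes by \<open>skew\<close>, and \<open>I x\<close> annihilates multiples of
    \<open>x\<close> by \<open>alt\<close>.\<close>
  then show "round_connection X (\<lambda>y. I y (X y)) x - I x (round_connection X X x) = 0"
    by (simp add: round_connection_def skew alt bounded_bilinear.add_right[OF bil]
        bounded_bilinear.scaleR_right[OF bil])
qed

section \<open>Complex frames and the orientation\<close>

lemma det_vector_7_add:
  fixes x :: "real^7"
  shows "det (vector [x, a + a', b, c, d, e, f] :: real^7^7) =
      det (vector [x, a, b, c, d, e, f] :: real^7^7) + det (vector [x, a', b, c, d, e, f] :: real^7^7)"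
    and "det (vector [x, a, b + b', c, d, e, f] :: real^7^7) =
      det (vector [x, a, b, c, d, e, f] :: real^7^7) + det (vector [x, a, b', c, d, e, f] :: real^7^7)"
proof -
  have 2: "(vector [x, u, b, c, d, e, f] :: real^7^7) =
      (\<chi> i. if i = 2 then u else vector [x, 0, b, c, d, e, f] $ i)" for u
    by (simp add: vec_eq_iff forall_7)
  have 3: "(vector [x, a, u, c, d, e, f] :: real^7^7) =
      (\<chi> i. if i = 3 then u else vector [x, a, 0, c, d, e, f] $ i)" for u
    by (simp add: vec_eq_iff forall_7)
  show "det (vector [x, a + a', b, c, d, e, f] :: real^7^7) =
      det (vector [x, a, b, c, d, e, f] :: real^7^7) + det (vector [x, a', b, c, d, e, f] :: real^7^7)"
    unfolding 2[of a] 2[of a'] 2[of "a + a'"] by (rule det_row_add)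
  show "det (vector [x, a, b + b', c, d, e, f] :: real^7^7) =
      det (vector [x, a, b, c, d, e, f] :: real^7^7) + det (vector [x, a, b', c, d, e, f] :: real^7^7)"
    unfolding 3[of b] 3[of b'] 3[of "b + b'"] by (rule det_row_add)
qed

lemma det_vector_7_diff:
  fixes x :: "real^7"
  shows "det (vector [x, a, b - b', c, d, e, f] :: real^7^7) =
      det (vector [x, a, b, c, d, e, f] :: real^7^7) - det (vector [x, a, b', c, d, e, f] :: real^7^7)"
  using det_vector_7_add(2)[of x a "b - b'" b' c d e f] by simp

lemma det_vector_7_scaleR:
  fixes x :: "real^7"
  shows "det (vector [x, r *\<^sub>R a, b, c, d, e, f] :: real^7^7) =
      r * det (vector [x, a, b, c, d, e, f] :: real^7^7)"
    and "det (vector [x, a, r *\<^sub>R b, c, d, e, f] :: real^7^7) =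
      r * det (vector [x, a, b, c, d, e, f] :: real^7^7)"
proof -
  have 2: "(vector [x, u, b, c, d, e, f] :: real^7^7) =
      (\<chi> i. if i = 2 then u else vector [x, 0, b, c, d, e, f] $ i)" for u
    by (simp add: vec_eq_iff forall_7)
  have 3: "(vector [x, a, u, c, d, e, f] :: real^7^7) =
      (\<chi> i. if i = 3 then u else vector [x, a, 0, c, d, e, f] $ i)" for u
    by (simp add: vec_eq_iff forall_7)
  show "det (vector [x, r *\<^sub>R a, b, c, d, e, f] :: real^7^7) =
      r * det (vector [x, a, b, c, d, e, f] :: real^7^7)"
    unfolding scalar_mult_eq_scaleR[symmetric] 2[of a] 2[of "r *s a"] by (rule det_row_mul)
  show "det (vector [x, a, r *\<^sub>R b, c, d, e, f] :: real^7^7) =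
      r * det (vector [x, a, b, c, d, e, f] :: real^7^7)"
    unfolding scalar_mult_eq_scaleR[symmetric] 3[of b] 3[of "r *s b"] by (rule det_row_mul)
qed

text \<open>Row linearity is available in the second and third rows, where the first pair of a
  complex frame stands; the exchanges bring the other pairs there. Exchanging two pairs takes two
  transpositions and so keeps the sign.\<close>

lemma det_vector_7_swap:
  fixes x :: "real^7"
  shows "det (vector [x, b, a, c, d, e, f] :: real^7^7) = - det (vector [x, a, b, c, d, e, f] :: real^7^7)"
    and "det (vector [x, c, d, a, b, e, f] :: real^7^7) = det (vector [x, a, b, c, d, e, f] :: real^7^7)"
    and "det (vector [x, e, f, c, d, a, b] :: real^7^7) = det (vector [x, a, b, c, d, e, f] :: real^7^7)"
proof -
  have swap: "det (\<chi> k. A $ Transposition.transpose i j k) = - det A" if "i \<noteq> j" for A :: "real^7^7" and i j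
    using det_permute_rows[OF permutes_swap_id[of i UNIV j], of A] that
    by (simp add: sign_swap_id)
  have 23: "(vector [x, b, a, c, d, e, f] :: real^7^7) =
      (\<chi> k. vector [x, a, b, c, d, e, f] $ Transposition.transpose 2 3 k)" for a b c d e f
    by (simp add: vec_eq_iff forall_7 Transposition.transpose_def)
  have 24: "(vector [x, c, b, a, d, e, f] :: real^7^7) =
      (\<chi> k. vector [x, a, b, c, d, e, f] $ Transposition.transpose 2 4 k)" for a b c d e f
    by (simp add: vec_eq_iff forall_7 Transposition.transpose_def)
  have 35: "(vector [x, a, d, c, b, e, f] :: real^7^7) =
      (\<chi> k. vector [x, a, b, c, d, e, f] $ Transposition.transpose 3 5 k)" for a b c d e f
    by (simp add: vec_eq_iff forall_7 Transposition.transpose_def)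
  have 26: "(vector [x, e, b, c, d, a, f] :: real^7^7) =
      (\<chi> k. vector [x, a, b, c, d, e, f] $ Transposition.transpose 2 6 k)" for a b c d e f
    by (simp add: vec_eq_iff forall_7 Transposition.transpose_def)
  have 37: "(vector [x, a, f, c, d, e, b] :: real^7^7) =
      (\<chi> k. vector [x, a, b, c, d, e, f] $ Transposition.transpose 3 7 k)" for a b c d e f
    by (simp add: vec_eq_iff forall_7 Transposition.transpose_def)
  show "det (vector [x, b, a, c, d, e, f] :: real^7^7) = - det (vector [x, a, b, c, d, e, f] :: real^7^7)"
    unfolding 23[of b a] by (rule swap) simp
  show "det (vector [x, c, d, a, b, e, f] :: real^7^7) = det (vector [x, a, b, c, d, e, f] :: real^7^7)"
    using swap[of 2 4 "vector [x, a, d, c, b, e, f]"] swap[of 3 5 "vector [x, a, b, c, d, e, f]"]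
    by (simp add: 24[symmetric] 35[symmetric])
  show "det (vector [x, e, f, c, d, a, b] :: real^7^7) = det (vector [x, a, b, c, d, e, f] :: real^7^7)"
    using swap[of 2 6 "vector [x, a, f, c, d, e, b]"] swap[of 3 7 "vector [x, a, b, c, d, e, f]"]
    by (simp add: 26[symmetric] 37[symmetric])
qed

lemma det_vector_7_repeated:
  fixes x :: "real^7"
  shows "det (vector [x, x, b, c, d, e, f] :: real^7^7) = 0"
    "det (vector [x, a, x, c, d, e, f] :: real^7^7) = 0"
    "det (vector [x, a, a, c, d, e, f] :: real^7^7) = 0"
    "det (vector [x, a, b, a, d, e, f] :: real^7^7) = 0"
    "det (vector [x, a, b, c, a, e, f] :: real^7^7) = 0"
    "det (vector [x, a, b, c, d, a, f] :: real^7^7) = 0"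
    "det (vector [x, a, b, c, d, e, a] :: real^7^7) = 0"
    "det (vector [x, a, b, b, d, e, f] :: real^7^7) = 0"
    "det (vector [x, a, b, c, b, e, f] :: real^7^7) = 0"
    "det (vector [x, a, b, c, d, b, f] :: real^7^7) = 0"
    "det (vector [x, a, b, c, d, e, b] :: real^7^7) = 0"
  subgoal by (rule det_identical_rows[of 1 2]) (simp_all add: row_def)
  subgoal by (rule det_identical_rows[of 1 3]) (simp_all add: row_def)
  subgoal by (rule det_identical_rows[of 2 3]) (simp_all add: row_def)
  subgoal by (rule det_identical_rows[of 2 4]) (simp_all add: row_def)
  subgoal by (rule det_identical_rows[of 2 5]) (simp_all add: row_def)
  subgoal by (rule det_identical_rows[of 2 6]) (simp_all add: row_def)
  subgoal by (rule det_identical_rows[of 2 7]) (simp_all add: row_def)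
  subgoal by (rule det_identical_rows[of 3 4]) (simp_all add: row_def)
  subgoal by (rule det_identical_rows[of 3 5]) (simp_all add: row_def)
  subgoal by (rule det_identical_rows[of 3 6]) (simp_all add: row_def)
  subgoal by (rule det_identical_rows[of 3 7]) (simp_all add: row_def)
  done

lemma det_complex_frame_swap:
  "det (complex_frame x J v2 v1 v3) = det (complex_frame x J v1 v2 v3)"
  "det (complex_frame x J v3 v2 v1) = det (complex_frame x J v1 v2 v3)"
  "det (complex_frame x J v1 v3 v2) = det (complex_frame x J v1 v2 v3)"
  unfolding complex_frame_def by (rule det_vector_7_swap | metis det_vector_7_swap(2,3))+

text \<open>Contributions of \<open>x\<close> and of the other two pairs repeat existing rows. On
  the pair \<open>v1\<close>, \<open>J v1\<close> the change of rows is multiplication by the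
  complex number with parts \<open>a1\<close> and \<open>b1\<close>, whose real determinant is its
  squared modulus. Allowing a multiple of \<open>x\<close> in \<open>JJ\<close> makes the condition
  meaningful for all vectors, not only tangent ones.\<close>

lemma det_complex_frame_combination:
  assumes "linear J" "J x = 0" and JJ: "\<And>v. \<exists>c. J (J v) = c *\<^sub>R x - v"
  shows "det (complex_frame x J (c *\<^sub>R x + a1 *\<^sub>R v1 + b1 *\<^sub>R J v1 + a2 *\<^sub>R v2 + b2 *\<^sub>R J v2 +
      a3 *\<^sub>R v3 + b3 *\<^sub>R J v3) v2 v3) = (a1\<^sup>2 + b1\<^sup>2) * det (complex_frame x J v1 v2 v3)"
proof -
  obtain c1 c2 c3 where JJv: "J (J v1) = c1 *\<^sub>R x - v1" "J (J v2) = c2 *\<^sub>R x - v2"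
      "J (J v3) = c3 *\<^sub>R x - v3"
    using JJ by metis
  show ?thesis
    by (simp add: complex_frame_def linear_add[OF assms(1)] linear_scale[OF assms(1)] assms(2) JJv
        scaleR_diff_right det_vector_7_add det_vector_7_diff det_vector_7_scaleR
        det_vector_7_repeated det_vector_7_swap(1)[of x "J v1" v1] power2_eq_square distrib_right
        del: scaleR_scaleR)
qed

lemma complex_frame_spans:
  assumes "det (complex_frame x J v1 v2 v3) \<noteq> 0"
  obtains c a1 b1 a2 b2 a3 b3 where
    "w = c *\<^sub>R x + a1 *\<^sub>R v1 + b1 *\<^sub>R J v1 + a2 *\<^sub>R v2 + b2 *\<^sub>R J v2 + a3 *\<^sub>R v3 + b3 *\<^sub>R J v3"
proof -
  let ?A = "complex_frame x J v1 v2 v3"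
  \<comment> \<open>Coefficients with respect to the rows of the frame solve a linear system with
    the transposed matrix.\<close>
  have "invertible (transpose ?A)"
    using assms by (simp add: invertible_det_nz)
  then obtain B where "transpose ?A ** B = mat 1"
    unfolding invertible_def by blast
  then have "transpose ?A *v (B *v w) = w"
    by (simp add: matrix_vector_mul_assoc)
  then have "w = (\<Sum>i\<in>UNIV. (B *v w) $ i *\<^sub>R row i ?A)"
    by (simp add: matrix_mult_sum scalar_mult_eq_scaleR)
  then show thesis
    unfolding sum_7 by (intro that) (simp add: row_def complex_frame_def)
qed

text \<open>
  The pairs of the first frame are exchanged for those of the second one by one; each time the
  determinant is multiplied by the squared modulus of a complex number.
\<close>

lemma complex_frames_same_sign:
  assumes J: "linear J" "J x = 0" "\<And>v. \<exists>c. J (J v) = c *\<^sub>R x - v"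
    and v: "det (complex_frame x J v1 v2 v3) > 0"
    and w: "det (complex_frame x J w1 w2 w3) \<noteq> 0"
  shows "det (complex_frame x J w1 w2 w3) > 0"
proof -
  let ?D = "\<lambda>u1 u2 u3. det (complex_frame x J u1 u2 u3)"
  note comb = det_complex_frame_combination[OF J]
  have pos: "?D w u2 u3 > 0"
    if "?D u1 u2 u3 > 0" "a1 \<noteq> 0 \<or> b1 \<noteq> 0"
      "w = c *\<^sub>R x + a1 *\<^sub>R u1 + b1 *\<^sub>R J u1 + a2 *\<^sub>R u2 + b2 *\<^sub>R J u2 + a3 *\<^sub>R u3 + b3 *\<^sub>R J u3"
    for w u1 u2 u3 c a1 b1 a2 b2 a3 b3
    unfolding that(3) comb using that(1,2) by (simp add: sum_power2_gt_zero_iff)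
  \<comment> \<open>With both coefficients of the first pair equal to zero, the squared modulus
    vanishes: a vector in the span of \<open>x\<close> and one pair cannot complete a frame
    containing that pair.\<close>
  have zero: "?D w u2 u3 = 0"
    if "w = c *\<^sub>R x + a2 *\<^sub>R u2 + b2 *\<^sub>R J u2" for w u2 u3 c a2 b2
    using comb[of c 0 0 0 a2 u2 b2 0 u3 0] that by simp
  have 1: "\<exists>u2 u3. ?D w1 u2 u3 > 0"
  proof -
    obtain c a1 b1 a2 b2 a3 b3 where e:
      "w1 = c *\<^sub>R x + a1 *\<^sub>R v1 + b1 *\<^sub>R J v1 + a2 *\<^sub>R v2 + b2 *\<^sub>R J v2 + a3 *\<^sub>R v3 + b3 *\<^sub>R J v3"
      using complex_frame_spans v by (metis less_irrefl)
    consider "a1 \<noteq> 0 \<or> b1 \<noteq> 0" | "a2 \<noteq> 0 \<or> b2 \<noteq> 0" | "a3 \<noteq> 0 \<or> b3 \<noteq> 0"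
      | "a1 = 0" "b1 = 0" "a2 = 0" "b2 = 0" "a3 = 0" "b3 = 0" by blast
    then show ?thesis
    proof cases
      case 1
      then show ?thesis using pos[OF v 1 e] by blast
    next
      case 2
      have "?D w1 v1 v3 > 0"
        by (rule pos[of v2 v1 v3 a2 b2 w1 c a1 b1 a3 b3])
          (use v 2 e in \<open>simp_all add: det_complex_frame_swap algebra_simps\<close>)
      then show ?thesis by blast
    next
      case 3
      have "?D w1 v2 v1 > 0"
        by (rule pos[of v3 v2 v1 a3 b3 w1 c a2 b2 a1 b1])
          (use v 3 e in \<open>simp_all add: det_complex_frame_swap algebra_simps\<close>)
      then show ?thesis by blast
    next
      case 4
      \<comment> \<open>Here \<open>w1\<close> is a multiple of \<open>x\<close>, which contradicts
        the nondegeneracy of the second frame.\<close>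
      then show ?thesis using w zero[of w1 c 0 w2 0 w3] e by simp
    qed
  qed
  then obtain u2 u3 where u: "?D w1 u2 u3 > 0" by blast
  have "\<exists>u. ?D w2 w1 u > 0"
  proof -
    obtain c a1 b1 a2 b2 a3 b3 where e:
      "w2 = c *\<^sub>R x + a1 *\<^sub>R w1 + b1 *\<^sub>R J w1 + a2 *\<^sub>R u2 + b2 *\<^sub>R J u2 + a3 *\<^sub>R u3 + b3 *\<^sub>R J u3"
      using complex_frame_spans u by (metis less_irrefl)
    consider "a2 \<noteq> 0 \<or> b2 \<noteq> 0" | "a3 \<noteq> 0 \<or> b3 \<noteq> 0"
      | "a2 = 0" "b2 = 0" "a3 = 0" "b3 = 0" by blast
    then show ?thesis
    proof cases
      case 1
      have "?D w2 w1 u3 > 0"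
        by (rule pos[of u2 w1 u3 a2 b2 w2 c a1 b1 a3 b3])
          (use u 1 e in \<open>simp_all add: det_complex_frame_swap algebra_simps\<close>)
      then show ?thesis by blast
    next
      case 2
      have "?D w2 w1 u2 > 0"
        by (rule pos[of u3 w1 u2 a3 b3 w2 c a1 b1 a2 b2])
          (use u 2 e in \<open>simp_all add: det_complex_frame_swap algebra_simps\<close>)
      then show ?thesis by blast
    next
      case 3
      \<comment> \<open>Now \<open>w2\<close> lies in the span of \<open>x\<close>,
        \<open>w1\<close> and \<open>J w1\<close>, again contradicting \<open>w\<close>.\<close>
      then show ?thesis
        using w zero[of w2 c a1 w1 b1 w3] e by (simp add: det_complex_frame_swap)
    qed
  qed
  then obtain u where u: "?D w2 w1 u > 0" by blast
  then have u': "?D u w1 w2 > 0" by (simp add: det_complex_frame_swap)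
  obtain c a1 b1 a2 b2 a3 b3 where e:
    "w3 = c *\<^sub>R x + a1 *\<^sub>R u + b1 *\<^sub>R J u + a2 *\<^sub>R w1 + b2 *\<^sub>R J w1 + a3 *\<^sub>R w2 + b3 *\<^sub>R J w2"
    using complex_frame_spans u' by (metis less_irrefl)
  have swap: "?D w3 w1 w2 = ?D w1 w2 w3"
    by (simp add: det_complex_frame_swap)
  \<comment> \<open>The other two pairs are already in place, so the nonvanishing of this
    determinant forces the squared modulus to be positive.\<close>
  have "?D w3 w1 w2 = (a1\<^sup>2 + b1\<^sup>2) * ?D u w1 w2"
    unfolding e by (rule comb)
  with w u' swap show ?thesis
    by (metis mult_eq_0_iff sum_power2_gt_zero_iff sum_power2_eq_zero_iff zero_less_mult_iff)
qed

text \<open>Unitary Gram-Schmidt: each new unit vector is chosen orthogonal to \<open>x\<close> and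
  to the earlier vectors and their images under \<open>J\<close>. These are at most five vectors in
  dimension seven, so a choice always exists.\<close>

lemma unitary_frame_exists:
  assumes x: "x \<in> S6" and "linear J"
    and tan: "\<And>v. v \<in> tangent x \<Longrightarrow> J v \<in> tangent x"
    and JJ: "\<And>v. v \<in> tangent x \<Longrightarrow> J (J v) = - v"
    and iso: "\<And>v w. v \<in> tangent x \<Longrightarrow> w \<in> tangent x \<Longrightarrow> J v \<bullet> J w = v \<bullet> w"
  obtains v1 v2 v3 where "v1 \<in> tangent x" "v2 \<in> tangent x" "v3 \<in> tangent x"
    "orthogonal_matrix (complex_frame x J v1 v2 v3)"
proof -
  have ex: "\<exists>v. norm v = 1 \<and> (\<forall>y\<in>S. v \<bullet> y = 0)" if "finite S" "card S < 7" for S :: "(real^7) set"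
  proof -
    have "dim S < DIM(real^7)"
      using dim_le_card'[OF that(1)] that(2) by simp
    then obtain v where "v \<noteq> 0" "\<And>y. y \<in> span S \<Longrightarrow> orthogonal v y"
      using orthogonal_to_subspace_exists by metis
    then show ?thesis
      by (intro exI[of _ "v /\<^sub>R norm v"]) (auto simp: orthogonal_def span_base)
  qed
  have skew: "J v \<bullet> w = - (v \<bullet> J w)" if "v \<in> tangent x" "w \<in> tangent x" for v w
    using iso[OF that(1) tan[OF that(2)]] JJ[OF that(2)] by simp
  obtain v1 where v1: "norm v1 = 1" "\<forall>y\<in>{x}. v1 \<bullet> y = 0"
    using ex[of "{x}"] by auto
  obtain v2 where v2: "norm v2 = 1" "\<forall>y\<in>{x, v1, J v1}. v2 \<bullet> y = 0"
    using ex[of "{x, v1, J v1}"] card_length[of "[x, v1, J v1]"] by auto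
  obtain v3 where v3: "norm v3 = 1" "\<forall>y\<in>{x, v1, J v1, v2, J v2}. v3 \<bullet> y = 0"
    using ex[of "{x, v1, J v1, v2, J v2}"] card_length[of "[x, v1, J v1, v2, J v2]"] by auto
  have t: "v1 \<in> tangent x" "v2 \<in> tangent x" "v3 \<in> tangent x"
    using v1 v2 v3 by (auto simp: tangent_def)
  have single: "norm (J v) = norm v" "J v \<bullet> x = 0" "x \<bullet> J v = 0" "v \<bullet> x = 0" "x \<bullet> v = 0"
      "v \<bullet> J v = 0" "J v \<bullet> v = 0" if "v \<in> tangent x" for v
    using iso[OF that that] tan[OF that] that skew[OF that that]
    by (auto simp: tangent_def norm_eq_sqrt_inner inner_commute)
  \<comment> \<open>Orthogonality to \<open>v\<close> and \<open>J v\<close> makes the complex lines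
    of \<open>v\<close> and \<open>w\<close> orthogonal, because \<open>J\<close> is skew and
    isometric on the tangent space.\<close>
  have pair: "w \<bullet> v = 0" "v \<bullet> w = 0" "w \<bullet> J v = 0" "J v \<bullet> w = 0" "J w \<bullet> v = 0" "v \<bullet> J w = 0"
      "J w \<bullet> J v = 0" "J v \<bullet> J w = 0"
    if "v \<in> tangent x" "w \<in> tangent x" "w \<bullet> v = 0" "w \<bullet> J v = 0" for v w
    using iso[OF that(1,2)] skew[OF that(1,2)] skew[OF that(2,1)] that
    by (auto simp: inner_commute)
  have "orthogonal_matrix (complex_frame x J v1 v2 v3)"
    unfolding orthogonal_matrix_orthonormal_rows forall_7 complex_frame_def row_def orthogonal_def
    using x v1 v2 v3
    by (simp add: single[OF t(1)] single[OF t(2)] single[OF t(3)]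
        pair[OF t(1,2)] pair[OF t(1,3)] pair[OF t(2,3)])
  with t show thesis by (rule that)
qed

section \<open>Identities of the Cayley product\<close>

lemma bounded_bilinear_cayley_J: "bounded_bilinear cayley_J"
  unfolding bilinear_conv_bounded_bilinear[symmetric] bilinear_def
  by (auto intro!: linearI simp: cayley_J_def octo_Im_def octo_mult_def octo_of_vec_def quat_mult_def
      quat_cnj_def vec_eq_iff forall_7 algebra_simps)

lemma cayley_J_self: "cayley_J x x = 0"
  by (simp add: cayley_J_def octo_Im_def octo_mult_def octo_of_vec_def quat_mult_def
      quat_cnj_def vec_eq_iff forall_7 algebra_simps)

lemma cayley_J_inner: "cayley_J x v \<bullet> x = 0" 
  by (simp add: cayley_J_def octo_Im_def octo_mult_def octo_of_vec_def quat_mult_def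
      quat_cnj_def inner_vec_def sum_7 algebra_simps)

lemma cayley_J_skew: "cayley_J x v \<bullet> w = - (v \<bullet> cayley_J x w)"
  by (simp add: cayley_J_def octo_Im_def octo_mult_def octo_of_vec_def quat_mult_def
      quat_cnj_def inner_vec_def sum_7 algebra_simps)

text \<open>The alternative law \<open>(v x) x = v (x x)\<close> for imaginary \<open>x\<close>; the
  term along \<open>x\<close> comes from discarding the real part of the inner product.\<close>

lemma cayley_J_twice: "cayley_J x (cayley_J x v) = (x \<bullet> v) *\<^sub>R x - (x \<bullet> x) *\<^sub>R v"
  by (simp add: cayley_J_def octo_Im_def octo_mult_def octo_of_vec_def quat_mult_def
      quat_cnj_def inner_vec_def sum_7 vec_eq_iff forall_7 algebra_simps)

lemma axis_component: "axis i x $ j = (if j = i then x else 0)"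
  by (simp add: axis_def)

lemma cayley_J_axis_1:
  "cayley_J (axis 1 1) v = vector [0, v $ 3, - (v $ 2), v $ 5, - (v $ 4), - (v $ 7), v $ 6]"
  by (simp add: cayley_J_def octo_Im_def octo_mult_def octo_of_vec_def quat_mult_def
      quat_cnj_def vec_eq_iff forall_7 axis_component)

lemma cayley_J_inner_self: "v \<bullet> cayley_J x v = 0"
  using cayley_J_skew[of x v v] by (simp add: inner_commute)

text \<open>The reference frame for the orientation: the structure at the first basis vector sends
  the second, fourth and sixth to minus the third, minus the fifth and plus the seventh. The matrix
  is diagonal with exactly two entries equal to -1.\<close>

lemma det_cayley_frame_axis:
  "det (complex_frame (axis 1 1) (cayley_J (axis 1 1)) (axis 2 1) (axis 4 1) (axis 6 1)) = 1"
proof -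
  let ?M = "complex_frame (axis 1 1) (cayley_J (axis 1 1)) (axis 2 1) (axis 4 1) (axis 6 1)"
  have "\<forall>i j. i \<noteq> j \<longrightarrow> ?M $ i $ j = 0"
    unfolding forall_7 complex_frame_def vector_7 cayley_J_axis_1 by (simp add: axis_component)
  then have "det ?M = (\<Prod>i\<in>UNIV. ?M $ i $ i)"
    by (simp add: det_diagonal)
  also have "\<dots> = 1"
    unfolding UNIV_7 complex_frame_def cayley_J_axis_1 by (simp add: axis_component)
  finally show ?thesis .
qed

lemma continuous_on_det_cayley_frame:
  "continuous_on UNIV (\<lambda>x. det (complex_frame x (cayley_J x) v1 v2 v3))"
proof -
  have [continuous_intros]: "continuous_on UNIV (\<lambda>x. cayley_J x v)" for v
    by (intro linear_continuous_on bounded_bilinear.bounded_linear_left[OF bounded_bilinear_cayley_J])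
  have "\<forall>i. continuous_on UNIV (\<lambda>x. complex_frame x (cayley_J x) v1 v2 v3 $ i)"
    unfolding forall_7 complex_frame_def by (simp add: continuous_intros)
  then have "continuous_on UNIV (\<lambda>x. complex_frame x (cayley_J x) v1 v2 v3 $ i $ j)" for i j
    using continuous_on_component by blast
  then show ?thesis
    unfolding det_def by (intro continuous_on_sum continuous_on_mult continuous_on_const continuous_on_prod)
qed

text \<open>
  The points with a frame of positive determinant, and those with one of negative determinant, form
  disjoint open sets that cover the sphere, which is connected.
\<close>

lemma induces_orientation_cayley_J:
  assumes "x \<in> S6"
  shows "induces_orientation 1 x (cayley_J x)"
proof -
  let ?f = "\<lambda>v1 v2 v3 x. det (complex_frame x (cayley_J x) v1 v2 v3)"
  \<comment> \<open>The vectors range over the whole space, tangent or not, so that one triple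
    serves all nearby points and openness of \<open>E r\<close> is continuity of the
    determinant.\<close>
  define E where "E r = {x. \<exists>v1 v2 v3. r * ?f v1 v2 v3 x > 0}" for r
  have open_E: "open (E r)" for r
  proof -
    have "E r = (\<Union>v1. \<Union>v2. \<Union>v3. {x. 0 < r * ?f v1 v2 v3 x})"
      by (auto simp: E_def)
    moreover have "open {x. 0 < r * ?f v1 v2 v3 x}" for v1 v2 v3
      by (intro open_Collect_less continuous_intros continuous_on_det_cayley_frame)
    ultimately show ?thesis by (simp add: open_UN)
  qed
  have J: "linear (cayley_J x)" "cayley_J x x = 0" "\<exists>c. cayley_J x (cayley_J x v) = c *\<^sub>R x - v"
    if "x \<in> S6" for x v
    using that bounded_bilinear.bounded_linear_right[OF bounded_bilinear_cayley_J]
    by (auto simp: cayley_J_self cayley_J_twice dot_square_norm bounded_linear.linear)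
  have same_sign: "?f w1 w2 w3 x > 0" if "x \<in> S6" "?f v1 v2 v3 x > 0" "?f w1 w2 w3 x \<noteq> 0"
    for x v1 v2 v3 w1 w2 w3
    by (rule complex_frames_same_sign[OF J[OF that(1)] that(2,3)])
  have disjoint: "E 1 \<inter> E (- 1) \<inter> S6 = {}"
  proof (rule equals0I)
    fix x assume "x \<in> E 1 \<inter> E (- 1) \<inter> S6"
    then obtain v1 v2 v3 w1 w2 w3 where "x \<in> S6" "?f v1 v2 v3 x > 0" "?f w1 w2 w3 x < 0"
      by (auto simp: E_def)
    with same_sign[of x v1 v2 v3 w1 w2 w3] show False by simp
  qed
  have cover: "S6 \<subseteq> E 1 \<union> E (- 1)"
  proof
    fix x :: "real^7" assume x: "x \<in> S6"
    obtain v1 v2 v3 where "orthogonal_matrix (complex_frame x (cayley_J x) v1 v2 v3)"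
    proof (rule unitary_frame_exists[OF x J(1)[OF x]])
      show "cayley_J x v \<in> tangent x" for v
        by (simp add: tangent_def cayley_J_inner)
      show "cayley_J x (cayley_J x v) = - v" if "v \<in> tangent x" for v
        using that x by (simp add: cayley_J_twice tangent_def dot_square_norm inner_commute)
      then show "cayley_J x v \<bullet> cayley_J x w = v \<bullet> w" if "v \<in> tangent x" "w \<in> tangent x" for v w
        using that by (simp add: cayley_J_skew)
    qed blast
    \<comment> \<open>An orthogonal matrix has determinant 1 or -1, so a unitary frame puts
      \<open>x\<close> in one of the two sets.\<close>
    then have "1 * ?f v1 v2 v3 x > 0 \<or> - 1 * ?f v1 v2 v3 x > 0"
      using det_orthogonal_matrix by fastforce
    then show "x \<in> E 1 \<union> E (- 1)"
      unfolding E_def by blast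
  qed
  have "1 * ?f (axis 2 1) (axis 4 1) (axis 6 1) (axis 1 1) > 0"
    by (simp add: det_cayley_frame_axis)
  then have "axis 1 1 \<in> E 1"
    unfolding E_def by blast
  then have "axis 1 1 \<in> E 1 \<inter> S6"
    by simp
  then have "E (- 1) \<inter> S6 = {}"
    using connectedD[OF connected_sphere open_E open_E disjoint cover] by auto
  with assms have x: "x \<notin> E (- 1)"
    by blast
  show ?thesis
    unfolding induces_orientation_def
  proof (intro ballI impI)
    fix v1 v2 v3 assume "?f v1 v2 v3 x \<noteq> 0"
    moreover have "\<not> - 1 * ?f v1 v2 v3 x > 0"
      using x unfolding E_def by blast
    ultimately show "1 * ?f v1 v2 v3 x > 0"
      by linarith
  qed
qed

text \<open>Uniqueness of the sign is decided at a single point, by the reference frame of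
  determinant 1.\<close>

lemma cayley_orientation_eq_1: "cayley_orientation = 1"
  unfolding cayley_orientation_def
proof (rule the_equality)
  show "(1 = 1 \<or> 1 = - 1) \<and> (\<forall>x\<in>S6. induces_orientation 1 x (cayley_J x))"
    using induces_orientation_cayley_J by simp
next
  fix r :: real
  assume r: "(r = 1 \<or> r = - 1) \<and> (\<forall>x\<in>S6. induces_orientation r x (cayley_J x))"
  have "axis 2 1 \<in> tangent (axis 1 1)" "axis 4 1 \<in> tangent (axis 1 1)" "axis 6 1 \<in> tangent (axis 1 1)"
    by (simp_all add: tangent_def inner_axis_axis)
  moreover have "induces_orientation r (axis 1 1) (cayley_J (axis 1 1))"
    using r by simp
  ultimately have "r > 0"
    using det_cayley_frame_axis unfolding induces_orientation_def by fastforce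
  then show "r = 1"
    using r by auto
qed

section \<open>Rotated Cayley structures\<close>

text \<open>Here \<open>v* A\<close> multiplies by the transpose, which inverts an orthogonal
  \<open>A\<close>, so this is the pullback of \<open>cayley_J\<close> by \<open>A\<close>. The
  formula makes sense on all of the ambient space and is bilinear there.\<close>

definition rotated_cayley_J :: "real^7^7 \<Rightarrow> real^7 \<Rightarrow> real^7 \<Rightarrow> real^7" where
  "rotated_cayley_J A x v = cayley_J (A *v x) (A *v v) v* A"

context
  fixes A :: "real^7^7"
  assumes orth: "orthogonal_matrix A" and det: "det A = 1"
begin

lemma rotation_cancel: "(A *v v) v* A = v" "A *v (v v* A) = v"
  using orth unfolding orthogonal_matrix_def transpose_matrix_vector[symmetric]
  by (simp_all add: matrix_vector_mul_assoc del: transpose_matrix_vector)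

lemma rotation_inner: "(A *v v) \<bullet> (A *v w) = v \<bullet> w"
  using orth orthogonal_transformation_matrix[of "(*v) A"]
  by (simp add: orthogonal_transformation_def)

lemma rotation_in_S6: "A *v x \<in> S6 \<longleftrightarrow> x \<in> S6"
  using rotation_inner[of x x] by (simp add: norm_eq_sqrt_inner)

lemma rotated_cayley_J_apply: "A *v rotated_cayley_J A x v = cayley_J (A *v x) (A *v v)"
  by (simp add: rotated_cayley_J_def rotation_cancel)

lemma bounded_bilinear_rotated_cayley_J: "bounded_bilinear (rotated_cayley_J A)"
  unfolding bilinear_conv_bounded_bilinear[symmetric] bilinear_def rotated_cayley_J_def
  by (auto intro!: linearI simp: matrix_vector_right_distrib matrix_vector_mult_scaleR
      vector_matrix_left_distrib scaleR_vector_matrix_assoc[symmetric]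
      bounded_bilinear.add_left[OF bounded_bilinear_cayley_J]
      bounded_bilinear.add_right[OF bounded_bilinear_cayley_J]
      bounded_bilinear.scaleR_left[OF bounded_bilinear_cayley_J]
      bounded_bilinear.scaleR_right[OF bounded_bilinear_cayley_J])

lemma rotated_cayley_J_self: "rotated_cayley_J A v v = 0"
  by (simp add: rotated_cayley_J_def cayley_J_self)

lemma rotated_cayley_J_inner_self: "v \<bullet> rotated_cayley_J A x v = 0"
  using cayley_J_inner_self[of "A *v v" "A *v x"]
  by (simp add: rotated_cayley_J_def inner_commute[of v] inner_commute[of "A *v v"] dot_lmul_matrix)

lemma nearly_kaehler_rotated_cayley_J: "nearly_kaehler (rotated_cayley_J A)"
  by (rule nearly_kaehler_bilinear[OF bounded_bilinear_rotated_cayley_J rotated_cayley_J_self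
        rotated_cayley_J_inner_self])

text \<open>Right multiplication by the transpose applies \<open>A\<close> to every row, and
  \<open>A\<close> intertwines the two complex structures. With \<open>det A = 1\<close>, frames at
  \<open>x\<close> and at \<open>A *v x\<close> have equal determinants.\<close>

lemma complex_frame_rotated_cayley_J:
  "complex_frame x (rotated_cayley_J A x) v1 v2 v3 ** transpose A =
    complex_frame (A *v x) (cayley_J (A *v x)) (A *v v1) (A *v v2) (A *v v3)"
proof -
  have row: "(M ** transpose A) $ i = A *v (M $ i)" for M :: "real^7^7" and i
    by (simp add: vec_eq_iff matrix_matrix_mult_def matrix_vector_mult_def transpose_def mult.commute)
  show ?thesis
    unfolding vec_eq_iff[of "_ ** _"] row forall_7
    by (simp add: complex_frame_def rotated_cayley_J_apply)
qed

lemma rotated_cayley_J_in_twistor_space: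
  assumes x: "x \<in> S6"
  shows "(x, rotated_cayley_J A x) \<in> twistor_space"
proof -
  let ?J = "rotated_cayley_J A x"
  have tangent_iff: "A *v v \<in> tangent (A *v x) \<longleftrightarrow> v \<in> tangent x" for v
    by (simp add: tangent_def rotation_inner)
  have JJ: "?J (?J v) = - v" if "v \<in> tangent x" for v
  proof -
    have "cayley_J (A *v x) (cayley_J (A *v x) (A *v v)) = A *v (- v)"
      using that x rotation_inner[of x v] rotation_inner[of x x]
      by (simp add: cayley_J_twice tangent_def dot_square_norm inner_commute[of v]
          linear_neg[OF matrix_vector_mul_linear])
    then show ?thesis
      by (simp add: rotated_cayley_J_def rotation_cancel)
  qed
  have "induces_orientation 1 x ?J"
    unfolding induces_orientation_def
  proof (intro ballI impI)
    fix v1 v2 v3 assume t: "v1 \<in> tangent x" "v2 \<in> tangent x" "v3 \<in> tangent x"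
      and nz: "det (complex_frame x ?J v1 v2 v3) \<noteq> 0"
    have "det (complex_frame x ?J v1 v2 v3) =
        det (complex_frame (A *v x) (cayley_J (A *v x)) (A *v v1) (A *v v2) (A *v v3))"
      using det by (simp add: complex_frame_rotated_cayley_J[symmetric] det_mul)
    with t nz show "1 * det (complex_frame x ?J v1 v2 v3) > 0"
      using induces_orientation_cayley_J[of "A *v x"] x
      unfolding induces_orientation_def rotation_in_S6 by (metis tangent_iff)
  qed
  moreover have "linear ?J"
    by (rule bounded_linear.linear[OF bounded_bilinear.bounded_linear_right[OF bounded_bilinear_rotated_cayley_J]])
  moreover have "?J v \<in> tangent x" for v
    by (simp add: tangent_def rotated_cayley_J_def dot_lmul_matrix cayley_J_inner)
  moreover have "?J v \<bullet> ?J w = v \<bullet> w" if "v \<in> tangent x" "w \<in> tangent x" for v w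
  proof -
    have "?J v \<bullet> ?J w = - (v \<bullet> ?J (?J w))"
      using rotation_inner[of v "?J (?J w)"] rotation_inner[of "?J v" "?J w"]
      by (simp add: rotated_cayley_J_apply cayley_J_skew)
    then show ?thesis using JJ[OF that(2)] by simp
  qed
  ultimately show ?thesis
    using x JJ by (simp add: twistor_space_def cayley_orientation_eq_1 rotated_cayley_J_self)
qed

text \<open>By bilinearity the matrix of the structure depends linearly on the base point, so
  smoothness is immediate.\<close>

lemma smooth_section_rotated_cayley_J: "smooth_section (rotated_cayley_J A)"
proof -
  have "linear (\<lambda>x. matrix (rotated_cayley_J A x))"
    by (rule linearI) (simp_all add: matrix_def vec_eq_iff
      bounded_bilinear.add_left[OF bounded_bilinear_rotated_cayley_J]
      bounded_bilinear.scaleR_left[OF bounded_bilinear_rotated_cayley_J])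
  then have "smooth_S6 (\<lambda>x. matrix (rotated_cayley_J A x))"
    by (intro smooth_S6_bounded_linear) (simp add: linear_conv_bounded_linear)
  then show ?thesis
    by (simp add: smooth_section_def rotated_cayley_J_in_twistor_space)
qed

end

text \<open>The rotation carries a unitary frame at \<open>p\<close> to the reference frame at the
  first basis vector. It intertwines the complex structures because it respects the pairing of frame
  vectors with their images.\<close>

lemma twistor_point_rotates_to_cayley:
  assumes "(p, Jp) \<in> twistor_space"
  obtains A where "orthogonal_matrix A" "det A = 1" "A *v p = axis 1 1"
    "\<And>v. A *v Jp v = cayley_J (axis 1 1) (A *v v)"
proof -
  from assms have p: "p \<in> S6" and lin: "linear Jp" and Jp0: "Jp p = 0"
    and tan: "\<And>v. v \<in> tangent p \<Longrightarrow> Jp v \<in> tangent p"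
    and JJ: "\<And>v. v \<in> tangent p \<Longrightarrow> Jp (Jp v) = - v"
    and iso: "\<And>v w. v \<in> tangent p \<Longrightarrow> w \<in> tangent p \<Longrightarrow> Jp v \<bullet> Jp w = v \<bullet> w"
    and ori: "induces_orientation 1 p Jp"
    by (auto simp: twistor_space_def cayley_orientation_eq_1)
  obtain v1 v2 v3 where v: "v1 \<in> tangent p" "v2 \<in> tangent p" "v3 \<in> tangent p"
    and M: "orthogonal_matrix (complex_frame p Jp v1 v2 v3)"
    using unitary_frame_exists[OF p lin tan JJ iso] by metis
  let ?M = "complex_frame p Jp v1 v2 v3"
  let ?N = "complex_frame (axis 1 1) (cayley_J (axis 1 1)) (axis 2 1) (axis 4 1) (axis 6 1)"
  \<comment> \<open>Orthogonality leaves the values 1 and -1; compatibility of \<open>Jp\<close>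
    with the orientation excludes -1.\<close>
  have detM: "det ?M = 1"
    using det_orthogonal_matrix[OF M] ori v unfolding induces_orientation_def by force
  have N: "orthogonal_matrix ?N"
    unfolding orthogonal_matrix_orthonormal_rows forall_7 row_def complex_frame_def orthogonal_def
      norm_eq_sqrt_inner inner_vec_def sum_7 by (simp add: cayley_J_axis_1 axis_component)
  have NM: "(?N ** ?M) *v w = vector [p \<bullet> w, v1 \<bullet> w, - (Jp v1 \<bullet> w), v2 \<bullet> w, - (Jp v2 \<bullet> w), v3 \<bullet> w, Jp v3 \<bullet> w]" for w
  proof -
    have M: "?M *v w = vector [p \<bullet> w, v1 \<bullet> w, Jp v1 \<bullet> w, v2 \<bullet> w, Jp v2 \<bullet> w, v3 \<bullet> w, Jp v3 \<bullet> w]"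
      unfolding vec_eq_iff forall_7 matrix_vector_mul_component by (simp add: complex_frame_def)
    have N: "?N *v u = vector [u $ 1, u $ 2, - (u $ 3), u $ 4, - (u $ 5), u $ 6, u $ 7]" for u
      unfolding vec_eq_iff forall_7 matrix_vector_mult_def complex_frame_def cayley_J_axis_1
      by (simp add: sum_7 axis_component)
    show ?thesis
      unfolding matrix_vector_mul_assoc[symmetric] M N by simp
  qed
  have pp: "p \<bullet> p = 1" using p by (simp add: dot_square_norm)
  have orth: "v \<bullet> p = 0" "Jp v \<bullet> p = 0" if "v \<in> tangent p" for v
    using that tan[OF that] by (auto simp: tangent_def)
  have proj: "\<exists>u\<in>tangent p. \<exists>c. w = u + c *\<^sub>R p" for w
    by (rule bexI[of _ "w - (w \<bullet> p) *\<^sub>R p"]) (auto simp: tangent_def inner_diff_left pp)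
  \<comment> \<open>The isometry property concerns tangent vectors only. Since \<open>Jp\<close>
    annihilates \<open>p\<close>, splitting off the normal part of \<open>w\<close> extends its
    consequences to all \<open>w\<close>.\<close>
  have inner_Jp: "p \<bullet> Jp w = 0" "v \<bullet> Jp w = - (Jp v \<bullet> w)" "Jp v \<bullet> Jp w = v \<bullet> w" if v: "v \<in> tangent p" for v w
  proof -
    obtain u c where u: "u \<in> tangent p" and w: "w = u + c *\<^sub>R p" using proj by blast
    have [simp]: "Jp (u + c *\<^sub>R p) = Jp u" by (simp add: linear_add[OF lin] linear_scale[OF lin] Jp0)
    show "p \<bullet> Jp w = 0" using orth(2)[OF u] by (simp add: w inner_commute)
    show "v \<bullet> Jp w = - (Jp v \<bullet> w)"
      using iso[OF tan[OF v] u] JJ[OF v] orth(2)[OF v] by (simp add: w inner_add_right)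
    show "Jp v \<bullet> Jp w = v \<bullet> w"
      using iso[OF v u] orth(1)[OF v] by (simp add: w inner_add_right)
  qed
  show thesis
  \<comment> \<open>\<open>?M\<close> sends the frame at \<open>p\<close> to the standard basis and
    the transpose of \<open>?N\<close> sends that to the reference frame. \<open>?N\<close> is
    diagonal, hence its own transpose.\<close>
  proof (rule that[of "?N ** ?M"])
    show "orthogonal_matrix (?N ** ?M)" by (rule orthogonal_matrix_mul[OF N M])
    show "det (?N ** ?M) = 1" by (simp add: det_mul detM det_cayley_frame_axis)
    show "(?N ** ?M) *v p = axis 1 1"
      using orth v by (simp add: NM vec_eq_iff forall_7 pp axis_component)
    show "(?N ** ?M) *v Jp w = cayley_J (axis 1 1) ((?N ** ?M) *v w)" for w
      unfolding NM cayley_J_axis_1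
      using v by (simp add: vec_eq_iff forall_7 inner_Jp(1)[OF v(1)] inner_Jp(2,3))
  qed
qed

text \<open>For the complex structure at the first basis vector this is the diagonal unitary matrix
  with entries \<open>exp(- i t)\<close>, 1, 1. Its complex determinant is not 1 unless
  \<open>t\<close> is a multiple of \<open>2 pi\<close>, so it leaves SU(3). Rows written as
  combinations of basis vectors allow the determinant to be expanded by row linearity.\<close>

definition rotation_23 :: "real \<Rightarrow> real^7^7" where
  "rotation_23 t = vector [axis 1 1, cos t *\<^sub>R axis 2 1 + (- sin t) *\<^sub>R axis 3 1,
     sin t *\<^sub>R axis 2 1 + cos t *\<^sub>R axis 3 1, axis 4 1, axis 5 1, axis 6 1, axis 7 1]"

lemma rotation_23_mult:
  "rotation_23 t *v v = vector [v $ 1, cos t * v $ 2 - sin t * v $ 3, sin t * v $ 2 + cos t * v $ 3,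
     v $ 4, v $ 5, v $ 6, v $ 7]"
  by (simp add: vec_eq_iff forall_7 matrix_vector_mult_def sum_7 rotation_23_def axis_component)

lemma orthogonal_matrix_rotation_23: "orthogonal_matrix (rotation_23 t)"
  using sin_cos_squared_add[of t] sin_cos_squared_add2[of t]
  unfolding orthogonal_matrix_orthonormal_rows forall_7 row_def rotation_23_def orthogonal_def
    norm_eq_sqrt_inner inner_vec_def sum_7 by (simp add: axis_component power2_eq_square)

lemma det_rotation_23: "det (rotation_23 t) = 1"
proof -
  have "vector [axis 1 1, axis 2 1, axis 3 1, axis 4 1, axis 5 1, axis 6 1, axis 7 1] = (mat 1 :: real^7^7)"
    by (simp add: vec_eq_iff forall_7 mat_def axis_component)
  then show ?thesis
    using sin_cos_squared_add[of t]
    unfolding rotation_23_def det_vector_7_add det_vector_7_scaleR det_vector_7_repeated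
      det_vector_7_swap(1)[of "axis 1 1" "axis 3 1" "axis 2 1"]
    by (simp add: power2_eq_square)
qed

text \<open>Complex linearity of the rotation, which is why all members of the family agree at
  \<open>p\<close>.\<close>

lemma cayley_J_axis_1_rotation_23:
  "cayley_J (axis 1 1) (rotation_23 t *v v) = rotation_23 t *v cayley_J (axis 1 1) v"
  by (simp add: rotation_23_mult cayley_J_axis_1 vec_eq_iff forall_7)

theorem theorem1:
  fixes p :: "real^7" and Jp :: "real^7 \<Rightarrow> real^7"
  assumes "(p, Jp) \<in> twistor_space"
  shows "\<exists>T I. one_parameter_family T I \<and>
           (\<forall>t \<in> T. smooth_section (I t) \<and> I t p = Jp \<and> nearly_kaehler (I t))"
proof -
  obtain A where A: "orthogonal_matrix A" "det A = 1" "A *v p = axis 1 1"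
    and AJ: "\<And>v. A *v Jp v = cayley_J (axis 1 1) (A *v v)"
    using twistor_point_rotates_to_cayley[OF assms] by metis
  \<comment> \<open>Every \<open>B t\<close> still moves \<open>p\<close> to the first basis vector
    and \<open>Jp\<close> to the structure there; only the values at other points change with
    \<open>t\<close>.\<close>
  define B where "B t = rotation_23 t ** A" for t
  have B: "orthogonal_matrix (B t)" "det (B t) = 1" for t
    using A by (simp_all add: B_def orthogonal_matrix_mul orthogonal_matrix_rotation_23 det_mul det_rotation_23)
  have B_mult: "B t *v v = rotation_23 t *v (A *v v)" for t v
    by (simp add: B_def matrix_vector_mul_assoc)
  define I where "I t = rotated_cayley_J (B t)" for t
  have "I t p = Jp" for t
  proof
    fix v
    have "B t *v I t p v = cayley_J (rotation_23 t *v axis 1 1) (B t *v v)"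
      unfolding I_def rotated_cayley_J_apply[OF B] by (simp add: B_mult A(3))
    also have "rotation_23 t *v axis 1 1 = axis 1 1"
      by (simp add: rotation_23_mult vec_eq_iff forall_7 axis_component)
    finally have "B t *v I t p v = B t *v Jp v"
      by (simp add: B_mult AJ cayley_J_axis_1_rotation_23)
    then show "I t p v = Jp v"
      by (metis rotation_cancel(1)[OF B])
  qed
  moreover have "one_parameter_family {0..1} I"
    unfolding one_parameter_family_def
  proof (intro conjI ballI impI)
    show "\<exists>a\<in>{0..1}. \<exists>b\<in>{0..1}. a < (b::real)" by (intro bexI[of _ 0] bexI[of _ 1]) auto
  next
    fix s t :: real assume st: "s \<in> {0..1}" "t \<in> {0..1}" "s \<noteq> t"
    \<comment> \<open>The fourth and sixth basis vectors are fixed by the rotation, but their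
      product is, up to sign, the second one, which is rotated. Pulling the two back by
      \<open>A\<close> gives a point and a vector that detect \<open>t\<close> through
      \<open>cos t\<close>.\<close>
    let ?x = "axis 4 1 v* A" and ?v = "axis 6 1 v* A"
    have "(A *v I t ?x ?v) $ 2 = - cos t" for t
    proof -
      have "B t *v ?x = axis 4 1" "B t *v ?v = axis 6 1"
        by (simp_all add: B_mult rotation_cancel[OF A(1,2)] rotation_23_mult vec_eq_iff forall_7 axis_component)
      then have "rotation_23 t *v (A *v I t ?x ?v) = cayley_J (axis 4 1) (axis 6 1)"
        using rotated_cayley_J_apply[OF B, of t ?x ?v] by (simp add: I_def B_mult)
      also have "\<dots> = - axis 2 1"
        by (simp add: cayley_J_def octo_Im_def octo_mult_def octo_of_vec_def quat_mult_def
            quat_cnj_def vec_eq_iff forall_7 axis_component complex_eq_iff)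
      finally have "A *v I t ?x ?v = (- axis 2 1) v* rotation_23 t"
        by (metis rotation_cancel(1)[OF orthogonal_matrix_rotation_23 det_rotation_23])
      then show ?thesis
        by (simp add: vector_matrix_mult_def sum_7 rotation_23_def axis_component)
    qed
    \<comment> \<open>Cosine is injective on the interval from 0 to \<open>pi\<close>, which
      contains \<open>{0..1}\<close>.\<close>
    moreover have "cos s \<noteq> cos t"
      using st cos_inj_pi[of s t] pi_ge_two by auto
    ultimately have "I s ?x \<noteq> I t ?x" by (metis neg_equal_iff_equal)
    moreover have "?x \<in> S6"
      using rotation_in_S6[OF A(1,2), of ?x] by (simp add: rotation_cancel[OF A(1,2)])
    ultimately show "\<exists>x\<in>S6. I s x \<noteq> I t x" by blast
  qed simp
  ultimately show ?thesis
    using smooth_section_rotated_cayley_J[OF B] nearly_kaehler_rotated_cayley_J[OF B]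
    unfolding I_def by blast
qed

end
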